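(* Let $\sigma$ be a symmetric operator mean with representing function $f$, and let $g$ be a real-valued function on $(0,\infty)$. (a) If $\sqrt{\cdot}\prec f$ and $g(A\#B)\le g(A\sigma B)$ for all positive definite $A,B$, then $g$ is operator monotone on $(0,\infty)$. (b) If $\sqrt{\cdot}\succ f$ and $g(A\#B)\ge g(A\sigma B)$ for all positive definite $A,B$, then $g$ is operator monotone on $(0,\infty)$.
   Context: Positive operators are taken to be positive definite complex $n\times n$ matrices, $n$ arbitrary; $\le$ is the Loewner order and functions of Hermitian matrices are defined by functional calculus. A real function $g$ on $(0,\infty)$ is operator monotone if for every $n$ and all positive definite $n\times n$ matrices $X\le Y$ one has $g(X)\le g(Y)$. An operator mean $\sigma$ (Kubo-Ando mean) is given by its representing function $f:(0,\infty)\to(0,\infty)$, operator monotone with $f(1)=1$, via $A\sigma B=A^{1/2}f(A^{-1/2}BA^{-1/2})A^{1/2}$. The geometric mean $\#$ has representing function $\sqrt t$. The mean $\sigma$ is symmetric if $A\sigma B=B\sigma A$ for all $A,B$; equivalently $f\in\mathcal F_{op}$, where $\mathcal F_{op}$ is the set of operator monotone $f:(0,\infty)\to(0,\infty)$ with $tf(t^{-1})=f(t)$ for all $t>0$ and $f(1)=1$. For $f,g\in\mathcal F_{op}$, $f\preceq g$ means that the function $\psi(t)=\frac{t+1}{2}\frac{f(t)}{g(t)}$ belongs to $\mathcal F_{op}$. It is known (Audenaert-Cai-Hansen) that each $f\in\mathcal F_{op}$ can be written as $$f(t)=\frac{1+t}{2}\exp\int_0^1\frac{(\lambda^2-1)(1-t)^2}{(t+\lambda)(1+t\lambda)(\lambda+1)^2}h_f(\lambda)\,d\lambda$$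 with $h_f:[0,1]\to[0,1]$ measurable and uniquely determined a.e. by $f$. One writes $f\prec g$ (or $g\succ f$) if $f\preceq g$ and $h_f\neq h_g$ on a set of non-zero measure (equivalently, $f\preceq g$ and $f\ne g$). *)

theory Defs
  imports
    "HOL-Analysis.Set_Integral"
    "HOL-Analysis.Lebesgue_Measure"
    "Jordan_Normal_Form.Schur_Decomposition"
begin

text \<open>Since the dimension is quantified inside the notions below (operator monotonicity, identities
  between means), matrices are carrier-based. Dimension 0 is not excluded; every condition is
  vacuous there.\<close>

definition hermitian_mat :: "nat \<Rightarrow> complex mat \<Rightarrow> bool" where
  "hermitian_mat n A \<longleftrightarrow> A \<in> carrier_mat n n \<and> mat_adjoint A = A"

definition unitary_mat :: "nat \<Rightarrow> complex mat \<Rightarrow> bool" where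
  "unitary_mat n U \<longleftrightarrow>
     U \<in> carrier_mat n n \<and> U * mat_adjoint U = 1\<^sub>m n \<and> mat_adjoint U * U = 1\<^sub>m n"

definition pos_semidef_mat :: "nat \<Rightarrow> complex mat \<Rightarrow> bool" where
  "pos_semidef_mat n A \<longleftrightarrow>
     hermitian_mat n A \<and> (\<forall>v\<in>carrier_vec n. 0 \<le> Re ((A *\<^sub>v v) \<bullet>c v))"

definition pos_def_mat :: "nat \<Rightarrow> complex mat \<Rightarrow> bool" where
  "pos_def_mat n A \<longleftrightarrow>
     hermitian_mat n A \<and> (\<forall>v\<in>carrier_vec n. v \<noteq> 0\<^sub>v n \<longrightarrow> 0 < Re ((A *\<^sub>v v) \<bullet>c v))"

definition loewner_le :: "nat \<Rightarrow> complex mat \<Rightarrow> complex mat \<Rightarrow> bool" where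
  "loewner_le n A B \<longleftrightarrow> hermitian_mat n A \<and> hermitian_mat n B \<and> pos_semidef_mat n (B - A)"

text \<open>Functional calculus: \<open>f (U D U\<^sup>*) = U f(D) U\<^sup>*\<close> for a unitary \<open>U\<close> and a real diagonal \<open>D\<close>.
  The value does not depend on the diagonalization; it is meaningful only for Hermitian \<open>A\<close>.\<close>

definition mat_fun :: "(real \<Rightarrow> real) \<Rightarrow> complex mat \<Rightarrow> complex mat" where
  "mat_fun f A = (let n = dim_row A in
     THE B. \<exists>U d. unitary_mat n U
       \<and> A = U * mat_diag n (\<lambda>i. complex_of_real (d i)) * mat_adjoint U
       \<and> B = U * mat_diag n (\<lambda>i. complex_of_real (f (d i))) * mat_adjoint U)"

text \<open>Functions on \<open>(0,\<infinity>)\<close> are total functions \<open>real \<Rightarrow> real\<close> whose values outside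
  \<open>(0,\<infinity>)\<close> are irrelevant.\<close>

definition operator_monotone :: "(real \<Rightarrow> real) \<Rightarrow> bool" where
  "operator_monotone g \<longleftrightarrow>
     (\<forall>n X Y. pos_def_mat n X \<and> pos_def_mat n Y \<and> loewner_le n X Y
        \<longrightarrow> loewner_le n (mat_fun g X) (mat_fun g Y))"

definition mean_of_fun :: "(real \<Rightarrow> real) \<Rightarrow> complex mat \<Rightarrow> complex mat \<Rightarrow> complex mat" where
  "mean_of_fun f A B =
     (let R = mat_fun sqrt A; S = mat_fun (\<lambda>t. 1 / sqrt t) A in R * mat_fun f (S * B * S) * R)"

definition operator_mean ::
    "(complex mat \<Rightarrow> complex mat \<Rightarrow> complex mat) \<Rightarrow> (real \<Rightarrow> real) \<Rightarrow> bool" where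
  "operator_mean \<sigma> f \<longleftrightarrow>
     (\<forall>t>0. f t > 0) \<and> operator_monotone f \<and> f 1 = 1 \<and>
     (\<forall>n A B. pos_def_mat n A \<and> pos_def_mat n B \<longrightarrow> \<sigma> A B = mean_of_fun f A B)"

definition symmetric_mean :: "(complex mat \<Rightarrow> complex mat \<Rightarrow> complex mat) \<Rightarrow> bool" where
  "symmetric_mean \<sigma> \<longleftrightarrow>
     (\<forall>n A B. pos_def_mat n A \<and> pos_def_mat n B \<longrightarrow> \<sigma> A B = \<sigma> B A)"

definition geometric_mean :: "complex mat \<Rightarrow> complex mat \<Rightarrow> complex mat" where
  "geometric_mean = mean_of_fun sqrt"

definition F_op :: "(real \<Rightarrow> real) set" where
  "F_op = {f. (\<forall>t>0. f t > 0) \<and> operator_monotone f \<and> (\<forall>t>0. t * f (1 / t) = f t) \<and> f 1 = 1}"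

definition preceq_op :: "(real \<Rightarrow> real) \<Rightarrow> (real \<Rightarrow> real) \<Rightarrow> bool" where
  "preceq_op f g \<longleftrightarrow> f \<in> F_op \<and> g \<in> F_op \<and> (\<lambda>t. (t + 1) / 2 * (f t / g t)) \<in> F_op"

text \<open>The Audenaert--Cai--Hansen representation. For \<open>f \<in> F_op\<close> such an \<open>h\<close> exists and is unique
  up to null sets of \<open>[0,1]\<close>; \<open>ach_fun f\<close> is a choice of representative.\<close>

definition ach_rep :: "(real \<Rightarrow> real) \<Rightarrow> (real \<Rightarrow> real) \<Rightarrow> bool" where
  "ach_rep f h \<longleftrightarrow>
     h \<in> borel_measurable (lebesgue_on {0..1}) \<and> (\<forall>l\<in>{0..1}. h l \<in> {0..1}) \<and>
     (\<forall>t>0. f t = (1 + t) / 2 *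
        exp (LINT l|lebesgue_on {0..1}.
               ((l\<^sup>2 - 1) * (1 - t)\<^sup>2) / ((t + l) * (1 + t * l) * (l + 1)\<^sup>2) * h l))"

definition ach_fun :: "(real \<Rightarrow> real) \<Rightarrow> real \<Rightarrow> real" where
  "ach_fun f = (SOME h. ach_rep f h)"

definition prec_op :: "(real \<Rightarrow> real) \<Rightarrow> (real \<Rightarrow> real) \<Rightarrow> bool" where
  "prec_op f g \<longleftrightarrow>
     preceq_op f g \<and> emeasure lebesgue {l \<in> {0..1}. ach_fun f l \<noteq> ach_fun g l} \<noteq> 0"

end

theory Submission
  imports Defs "Jordan_Normal_Form.Spectral_Radius"
begin

text \<open>Positive definite matrices \<open>X \<le> Y\<close> are simultaneously diagonalized by a congruence,
  \<open>X = C C\<^sup>*\<close> and \<open>Y = C diag(z) C\<^sup>*\<close> with \<open>z \<ge> 1\<close>, and operator means are invariant under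
  congruence, so on matrices \<open>C diag(a) C\<^sup>*\<close> they act entrywise:
  \<open>a\<^sub>i f(b\<^sub>i / a\<^sub>i)\<close>. With \<open>a = z / \<surd>s\<close>, \<open>b = z \<surd>s\<close> the geometric mean gives \<open>z\<close> and \<open>\<sigma>\<close> gives
  \<open>z f(s) / \<surd>s\<close>. The function \<open>f(s) / \<surd>s\<close> is continuous with value 1 at 1, and in case (a) it
  takes some value \<open>c > 1\<close>, hence all of \<open>[1, c]\<close>; this yields \<open>g(X) \<le> g(Y)\<close> as long as
  \<open>z \<le> c\<close>, and a chain of such steps connects any \<open>X \<le> Y\<close>. Case (b) is symmetric.

  That \<open>f(s) / \<surd>s\<close> stays on one side of 1 is the bound \<open>\<psi>(t) \<le> (1 + t) / 2\<close> for \<open>\<psi> \<in> F_op\<close>, which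
  follows from operator monotonicity applied to a single pair of \<open>2 \<times> 2\<close> matrices.\<close>

subsection \<open>Adjoints and congruences of real diagonal matrices\<close>

unbundle no vec_syntax

lemma square_mult_carrier [simp]:
  "A \<in> carrier_mat n n \<Longrightarrow> B \<in> carrier_mat n n \<Longrightarrow> A * B \<in> carrier_mat n n"
  by (rule mult_carrier_mat)

lemma square_mult_vec_carrier [simp]:
  "A \<in> carrier_mat n n \<Longrightarrow> v \<in> carrier_vec n \<Longrightarrow> A *\<^sub>v v \<in> carrier_vec n"
  by (rule mult_mat_vec_carrier)

lemma square_mult_one [simp]:
  fixes A :: "'a :: semiring_1 mat"
  assumes "A \<in> carrier_mat n n"
  shows "1\<^sub>m n * A = A" "A * 1\<^sub>m n = A"
  using assms by (rule left_mult_one_mat right_mult_one_mat)+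

lemma dim_mat_adjoint [simp]:
  "dim_row (mat_adjoint A) = dim_col A" "dim_col (mat_adjoint A) = dim_row A"
  by (simp_all add: mat_adjoint_def)

lemma mat_adjoint_carrier [simp]:
  "A \<in> carrier_mat n m \<Longrightarrow> mat_adjoint A \<in> carrier_mat m n"
  by (metis carrier_matD carrier_matI dim_mat_adjoint)

lemma index_mat_adjoint [simp]:
  "i < dim_col A \<Longrightarrow> j < dim_row A \<Longrightarrow> mat_adjoint A $$ (i, j) = conjugate (A $$ (j, i))"
  by (simp add: mat_adjoint_def mat_of_rows_def)

lemma mat_adjoint_adjoint [simp]: "mat_adjoint (mat_adjoint A) = A"
  by (rule eq_matI) auto

lemma mat_adjoint_mult:
  fixes A B :: "complex mat"
  assumes "A \<in> carrier_mat n m" "B \<in> carrier_mat m k"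
  shows "mat_adjoint (A * B) = mat_adjoint B * mat_adjoint A"
  using assms by (intro eq_matI) (auto simp: scalar_prod_def mult.commute)

lemma mat_adjoint_one [simp]: "mat_adjoint (1\<^sub>m n :: complex mat) = 1\<^sub>m n"
  by (rule eq_matI) auto

lemma mat_adjoint_diag_real [simp]:
  "mat_adjoint (mat_diag n (\<lambda>i. complex_of_real (d i))) = mat_diag n (\<lambda>i. complex_of_real (d i))"
  by (rule eq_matI) (auto simp: mat_diag_def)

lemma mat_diag_cong: "(\<And>i. i < n \<Longrightarrow> d i = e i) \<Longrightarrow> mat_diag n d = mat_diag n e"
  by (rule eq_matI) (auto simp: mat_diag_def)

text \<open>Since \<open>C\<close> is arbitrary, one notation serves for spectral decompositions
  (\<open>C\<close> unitary) and for congruences (\<open>C\<close> invertible).\<close>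

definition cdiag :: "nat \<Rightarrow> complex mat \<Rightarrow> (nat \<Rightarrow> real) \<Rightarrow> complex mat" where
  "cdiag n C d = C * mat_diag n (\<lambda>i. complex_of_real (d i)) * mat_adjoint C"

lemma cdiag_carrier [simp]: "C \<in> carrier_mat n n \<Longrightarrow> cdiag n C d \<in> carrier_mat n n"
  unfolding cdiag_def by simp

lemma dim_cdiag [simp]:
  "dim_row (cdiag n C d) = dim_row C" "dim_col (cdiag n C d) = dim_row C"
  by (simp_all add: cdiag_def)

lemma cdiag_cong: "(\<And>i. i < n \<Longrightarrow> d i = e i) \<Longrightarrow> cdiag n C d = cdiag n C e"
  unfolding cdiag_def by (simp cong: mat_diag_cong)

lemma cdiag_index:
  assumes "C \<in> carrier_mat n n" "i < n" "j < n"
  shows "cdiag n C d $$ (i, j) = (\<Sum>k<n. C $$ (i, k) * d k * cnj (C $$ (j, k)))"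
  using assms unfolding cdiag_def
  by (subst mat_diag_mult_right[of _ n n]) (auto simp: scalar_prod_def atLeast0LessThan)

lemma hermitian_cdiag: "C \<in> carrier_mat n n \<Longrightarrow> hermitian_mat n (cdiag n C d)"
  unfolding hermitian_mat_def cdiag_def
  by (simp add: mat_adjoint_mult[of _ n n _ n] assoc_mult_mat[of _ n n _ n _ n])

lemma cdiag_mult:
  assumes [simp]: "R \<in> carrier_mat n n" "C \<in> carrier_mat n n"
  shows "R * cdiag n C d * mat_adjoint R = cdiag n (R * C) d"
  unfolding cdiag_def
  by (simp add: mat_adjoint_mult[of _ n n _ n] assoc_mult_mat[of _ n n _ n _ n])

lemma cdiag_one: "C \<in> carrier_mat n n \<Longrightarrow> cdiag n C (\<lambda>_. 1) = C * mat_adjoint C"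
  unfolding cdiag_def by simp

text \<open>A diagonal factor of \<open>C\<close> can be absorbed into the diagonal; this later
  normalizes the first of two congruent diagonal matrices.\<close>

lemma cdiag_scale:
  assumes C [simp]: "C \<in> carrier_mat n n"
  shows "cdiag n (C * mat_diag n (\<lambda>i. complex_of_real (r i))) d = cdiag n C (\<lambda>i. r i * d i * r i)"
  by (rule eq_matI) (simp_all add: cdiag_index mat_diag_mult_right[OF C] ac_simps carrier_matD[OF C])

lemma cdiag_diff:
  assumes "C \<in> carrier_mat n n"
  shows "cdiag n C d - cdiag n C e = cdiag n C (\<lambda>i. d i - e i)"
  by (rule eq_matI)
    (use assms in \<open>auto simp: cdiag_index sum_subtractf algebra_simps 
      carrier_matD[OF cdiag_carrier]\<close>)

section \<open>Quadratic forms and definiteness of congruent diagonal matrices\<close>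

lemma quad_form:
  fixes M :: "complex mat"
  assumes "M \<in> carrier_mat n n" "v \<in> carrier_vec n"
  shows "(M *\<^sub>v v) \<bullet>c v = (\<Sum>i<n. \<Sum>j<n. M $$ (i, j) * v $ j * cnj (v $ i))"
  using assms by (auto simp: scalar_prod_def atLeast0LessThan sum_distrib_right)

lemma quad_form_adjoint:
  fixes C :: "complex mat"
  assumes "C \<in> carrier_mat n n" "w \<in> carrier_vec n" "v \<in> carrier_vec n"
  shows "(C *\<^sub>v w) \<bullet>c v = w \<bullet>c (mat_adjoint C *\<^sub>v v)"
proof -
  have "(C *\<^sub>v w) \<bullet>c v = (\<Sum>i<n. \<Sum>j<n. C $$ (i, j) * w $ j * cnj (v $ i))"
    using assms by (auto simp: scalar_prod_def atLeast0LessThan sum_distrib_right)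
  also have "\<dots> = (\<Sum>j<n. \<Sum>i<n. C $$ (i, j) * w $ j * cnj (v $ i))"
    by (rule sum.swap)
  also have "\<dots> = w \<bullet>c (mat_adjoint C *\<^sub>v v)"
    using assms by (auto simp: scalar_prod_def atLeast0LessThan sum_distrib_left ac_simps intro!: sum.cong)
  finally show ?thesis .
qed

text \<open>In the coordinates \<open>w = mat_adjoint C *\<^sub>v v\<close> the form is diagonal, so
  its sign can be read off from \<open>d\<close>.\<close>

lemma quad_form_cdiag:
  assumes [simp]: "C \<in> carrier_mat n n" and [simp]: "v \<in> carrier_vec n"
  shows "Re ((cdiag n C d *\<^sub>v v) \<bullet>c v) = (\<Sum>i<n. d i * (cmod ((mat_adjoint C *\<^sub>v v) $ i))\<^sup>2)"
proof -
  define w where "w = mat_adjoint C *\<^sub>v v"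
  have w [simp]: "w \<in> carrier_vec n" unfolding w_def by simp
  have "cdiag n C d *\<^sub>v v = C *\<^sub>v (mat_diag n (\<lambda>i. complex_of_real (d i)) *\<^sub>v w)"
    unfolding w_def cdiag_def by (simp add: assoc_mult_mat_vec[of _ n n _ n])
  then have "(cdiag n C d *\<^sub>v v) \<bullet>c v = (mat_diag n (\<lambda>i. complex_of_real (d i)) *\<^sub>v w) \<bullet>c w"
    by (simp add: quad_form_adjoint[of _ n] w_def)
  also have "\<dots> = (\<Sum>i<n. complex_of_real (d i) * (w $ i * cnj (w $ i)))"
    by (subst quad_form[of _ n]) (auto simp: mat_diag_def if_distrib if_distribR sum.delta' mult.assoc cong: if_cong)
  finally show ?thesis
    unfolding w_def by (simp add: complex_norm_square[symmetric] flip: of_real_power)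
qed

lemma pos_semidef_cdiag:
  assumes "C \<in> carrier_mat n n" "\<And>i. i < n \<Longrightarrow> 0 \<le> d i"
  shows "pos_semidef_mat n (cdiag n C d)"
  unfolding pos_semidef_mat_def using assms
  by (auto simp: hermitian_cdiag quad_form_cdiag intro!: sum_nonneg)

text \<open>Invertibility enters as an explicit left inverse \<open>D\<close>. Its adjoint recovers
  \<open>v\<close> from \<open>w\<close>, so \<open>w\<close> vanishes only if \<open>v\<close>
  does.\<close>

lemma pos_def_cdiag:
  assumes C: "C \<in> carrier_mat n n" and D: "D \<in> carrier_mat n n" and CD: "D * C = 1\<^sub>m n"
    and d: "\<And>i. i < n \<Longrightarrow> 0 < d i"
  shows "pos_def_mat n (cdiag n C d)"
  unfolding pos_def_mat_def
proof (intro conjI ballI impI)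
  fix v :: "complex vec" assume v: "v \<in> carrier_vec n" "v \<noteq> 0\<^sub>v n"
  define w where "w = mat_adjoint C *\<^sub>v v"
  have w: "w \<in> carrier_vec n" unfolding w_def using C v by simp
  have "mat_adjoint D *\<^sub>v w = v"
    using C D v CD mat_mult_left_right_inverse[OF D C CD]
    by (simp add: w_def flip: assoc_mult_mat_vec[of _ n n _ n] mat_adjoint_mult[of _ n n _ n])
  with v D have "w \<noteq> 0\<^sub>v n" by auto
  then obtain i where i: "i < n" "w $ i \<noteq> 0" using w by (metis eq_vecI carrier_vecD index_zero_vec)
  have "0 < (\<Sum>i<n. d i * (cmod (w $ i))\<^sup>2)"
    by (rule sum_pos2[of _ i]) (use i d in \<open>auto simp: less_imp_le\<close>)
  then show "0 < Re ((cdiag n C d *\<^sub>v v) \<bullet>c v)"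
    using C v unfolding w_def by (simp add: quad_form_cdiag)
qed (use C in \<open>simp add: hermitian_cdiag\<close>)

text \<open>The adjoint of \<open>D\<close> inverts that of \<open>C\<close>, so some
  \<open>v\<close> has the \<open>i\<close>-th unit vector as its coordinates. This yields the
  converse criteria, from definiteness back to the signs of \<open>d\<close>.\<close>

lemma quad_form_cdiag_attains:
  assumes C: "C \<in> carrier_mat n n" and D: "D \<in> carrier_mat n n" and DC: "D * C = 1\<^sub>m n"
    and i: "i < n"
  obtains v where "v \<in> carrier_vec n" "v \<noteq> 0\<^sub>v n" "Re ((cdiag n C d *\<^sub>v v) \<bullet>c v) = d i"
proof
  define v where "v = mat_adjoint D *\<^sub>v unit_vec n i"
  show v: "v \<in> carrier_vec n" unfolding v_def using D by simp
  have e: "mat_adjoint C *\<^sub>v v = unit_vec n i"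
    using C D DC unfolding v_def
    by (simp flip: assoc_mult_mat_vec[of _ n n _ n] mat_adjoint_mult[of _ n n _ n])
  have "mat_adjoint C *\<^sub>v 0\<^sub>v n = 0\<^sub>v n" using C by (intro eq_vecI) auto
  moreover have "unit_vec n i \<noteq> (0\<^sub>v n :: complex vec)"
    using i by (metis index_unit_vec(2) index_zero_vec(1) zero_neq_one)
  ultimately show "v \<noteq> 0\<^sub>v n" using e by auto
  have "Re ((cdiag n C d *\<^sub>v v) \<bullet>c v) = (\<Sum>k<n. if k = i then d k else 0)"
    unfolding quad_form_cdiag[OF C v] e by (rule sum.cong) (use i in auto)
  also have "\<dots> = d i" using i by simp
  finally show "Re ((cdiag n C d *\<^sub>v v) \<bullet>c v) = d i" .
qed

lemma pos_semidef_cdiagD: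
  assumes "C \<in> carrier_mat n n" "D \<in> carrier_mat n n" "D * C = 1\<^sub>m n" "i < n"
    and "pos_semidef_mat n (cdiag n C d)"
  shows "0 \<le> d i"
  using quad_form_cdiag_attains[OF assms(1-4)] assms(5) unfolding pos_semidef_mat_def by metis

lemma pos_def_cdiagD:
  assumes "C \<in> carrier_mat n n" "D \<in> carrier_mat n n" "D * C = 1\<^sub>m n" "i < n"
    and "pos_def_mat n (cdiag n C d)"
  shows "0 < d i"
  using quad_form_cdiag_attains[OF assms(1-4)] assms(5) unfolding pos_def_mat_def by metis

subsection \<open>Spectral theorem and functional calculus\<close>

lemma unitary_mat_one [simp]: "unitary_mat n (1\<^sub>m n)"
  by (simp add: unitary_mat_def)

lemma unitary_matI:
  assumes "U \<in> carrier_mat n n" "mat_adjoint U * U = 1\<^sub>m n"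
  shows "unitary_mat n U"
  using assms mat_mult_left_right_inverse[of "mat_adjoint U" n U] by (simp add: unitary_mat_def)

lemma unitary_mat_mult:
  assumes "unitary_mat n U" "unitary_mat n V"
  shows "unitary_mat n (U * V)"
proof (rule unitary_matI)
  have [simp]: "U \<in> carrier_mat n n" "V \<in> carrier_mat n n"
    and U: "mat_adjoint U * U = 1\<^sub>m n" and V: "mat_adjoint V * V = 1\<^sub>m n"
    using assms by (auto simp: unitary_mat_def)
  have "mat_adjoint (U * V) * (U * V) = mat_adjoint V * (mat_adjoint U * U) * V"
    by (simp add: mat_adjoint_mult[of _ n n _ n] assoc_mult_mat[of _ n n _ n _ n])
  also have "\<dots> = 1\<^sub>m n" by (simp add: U V)
  finally show "mat_adjoint (U * V) * (U * V) = 1\<^sub>m n" .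
qed (use assms in \<open>simp add: unitary_mat_def\<close>)

text \<open>Complete \<open>v\<close> to a basis, orthogonalize and normalize. Gram-Schmidt leaves
  its first vector unchanged, so the first column is still a multiple of \<open>v\<close>.\<close>

lemma unitary_extension:
  fixes v :: "complex vec"
  assumes v: "v \<in> carrier_vec n" and v0: "v \<noteq> 0\<^sub>v n"
  obtains U c where "unitary_mat n U" "col U 0 = c \<cdot>\<^sub>v v"
proof -
  interpret cof_vec_space n "TYPE(complex)" .
  define b where "b = basis_completion v"
  define ws where "ws = gram_schmidt n b"
  note b = basis_completion[OF v v0, folded b_def]
  have n: "0 < n" using v v0 by (cases n) auto
  with b(6) b(7) obtain vs where bv: "b = v # vs" by (cases b) auto
  note gs = gram_schmidt_result[OF b(2) b(4) b(5) ws_def]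
  have len: "length ws = n" using gs(4) b(6) by simp
  have "hd ws = v" using gram_schmidt_hd[OF v, of vs] bv unfolding ws_def by simp
  then have ws0: "ws ! 0 = v" using len n by (cases ws) auto
  have wc: "ws ! i \<in> carrier_vec n" if "i < n" for i using gs(3) len that by auto
  define r where "r i = sqrt (Re (ws ! i \<bullet>c ws ! i))" for i
  \<comment> \<open>In the order on complex numbers, being nonnegative includes having zero
    imaginary part, so the squared norm equals its real part.\<close>
  have sq: "ws ! i \<bullet>c ws ! i = complex_of_real (r i * r i)" and r0: "r i \<noteq> 0" if "i < n" for i
  proof -
    have "ws ! i \<bullet>c ws ! i \<ge> 0" by (rule conjugate_square_ge_0_vec)
    moreover have "ws ! i \<bullet>c ws ! i \<noteq> 0" using corthogonalD[OF gs(2), of i i] that len by simp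
    ultimately show "ws ! i \<bullet>c ws ! i = complex_of_real (r i * r i)" "r i \<noteq> 0"
      unfolding r_def by (auto simp: less_eq_complex_def complex_eq_iff)
  qed
  define U where "U = mat n n (\<lambda>(i, j). (1 / complex_of_real (r j)) * (ws ! j $ i))"
  have U: "U \<in> carrier_mat n n" unfolding U_def by simp
  have colU: "col U j = (1 / complex_of_real (r j)) \<cdot>\<^sub>v ws ! j" if "j < n" for j
    using that wc[OF that] unfolding U_def by (intro eq_vecI) auto
  have "mat_adjoint U * U = 1\<^sub>m n"
  proof (rule eq_matI)
    fix i j assume "i < dim_row (1\<^sub>m n :: complex mat)" "j < dim_col (1\<^sub>m n :: complex mat)"
    then have ij: "i < n" "j < n" by auto
    have "(mat_adjoint U * U) $$ (i, j) = (\<Sum>k<n. cnj (U $$ (k, i)) * U $$ (k, j))"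
      using U ij by (simp add: scalar_prod_def atLeast0LessThan)
    also have "\<dots> = (1 / complex_of_real (r i)) * (1 / complex_of_real (r j)) * (ws ! j \<bullet>c ws ! i)"
      using ij wc[OF ij(1)] wc[OF ij(2)] unfolding U_def
      by (simp add: scalar_prod_def atLeast0LessThan sum_distrib_left sum_divide_distrib ac_simps)
    also have "\<dots> = (if i = j then 1 else 0)"
      using corthogonalD[OF gs(2), of j i] ij len sq[OF ij(1)] r0[OF ij(1)] by auto
    finally show "(mat_adjoint U * U) $$ (i, j) = 1\<^sub>m n $$ (i, j)" using ij by simp
  qed (use U in auto)
  with U have "unitary_mat n U" by (rule unitary_matI)
  with colU[OF n] ws0 that show ?thesis by metis
qed

lemma hermitian_congruence:
  assumes "hermitian_mat n A" "C \<in> carrier_mat n n"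
  shows "hermitian_mat n (C * A * mat_adjoint C)"
  using assms unfolding hermitian_mat_def
  by (simp add: mat_adjoint_mult[of _ n n _ n] assoc_mult_mat[of _ n n _ n _ n])

lemma cdiag_unitary_conj:
  assumes U: "unitary_mat n U" and A: "A \<in> carrier_mat n n" and V: "V \<in> carrier_mat n n"
    and eq: "mat_adjoint U * A * U = cdiag n V d"
  shows "A = cdiag n (U * V) d"
proof -
  have [simp]: "U \<in> carrier_mat n n" and UU: "U * mat_adjoint U = 1\<^sub>m n"
    using U by (auto simp: unitary_mat_def)
  have "A = (U * mat_adjoint U) * A * (U * mat_adjoint U)" using A by (simp add: UU)
  also have "\<dots> = U * (mat_adjoint U * A * U) * mat_adjoint U"
    using A by (simp add: assoc_mult_mat[of _ n n _ n _ n])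
  finally show ?thesis using V by (simp add: eq cdiag_mult)
qed

lemma hermitian_index:
  assumes "hermitian_mat n A" "i < n" "j < n"
  shows "A $$ (i, j) = cnj (A $$ (j, i))"
proof -
  have A: "A \<in> carrier_mat n n" "mat_adjoint A = A" using assms by (auto simp: hermitian_mat_def)
  then have "A $$ (i, j) = mat_adjoint A $$ (i, j)" by simp
  also have "\<dots> = cnj (A $$ (j, i))" using A(1) assms by (subst index_mat_adjoint) auto
  finally show ?thesis .
qed

text \<open>Deflation: in a unitary basis that starts with an eigenvector, the matrix splits into a
  \<open>1 x 1\<close> block and a Hermitian block of size \<open>n\<close>, to which the induction
  hypothesis applies.\<close>

theorem hermitian_spectral:
  assumes "hermitian_mat n A"
  obtains U d where "unitary_mat n U" "A = cdiag n U d"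
  using assms
proof (induction n arbitrary: A thesis)
  case 0
  have "A \<in> carrier_mat 0 0"
    using 0 by (auto simp: hermitian_mat_def)
  then have "A = cdiag 0 (1\<^sub>m 0) (\<lambda>_. 0)" by (intro eq_matI) auto
  then show ?case using 0 unitary_mat_one by blast
next
  case (Suc n)
  let ?m = "Suc n"
  have A: "A \<in> carrier_mat ?m ?m" using Suc.prems(2) by (simp add: hermitian_mat_def)
  obtain e where "eigenvalue A e"
    using spectrum_non_empty[OF A] by (auto simp: spectrum_def)
  then obtain v where v: "v \<in> carrier_vec ?m" "v \<noteq> 0\<^sub>v ?m" "A *\<^sub>v v = e \<cdot>\<^sub>v v"
    using A by (auto simp: eigenvalue_def eigenvector_def)
  obtain U c where U: "unitary_mat ?m U" and colU: "col U 0 = c \<cdot>\<^sub>v v"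
    using unitary_extension[OF v(1,2)] .
  have Uc [simp]: "U \<in> carrier_mat ?m ?m" and UU: "mat_adjoint U * U = 1\<^sub>m ?m"
    using U by (auto simp: unitary_mat_def)
  define B where "B = mat_adjoint U * A * U"
  have Bc: "B \<in> carrier_mat ?m ?m" unfolding B_def using A by simp
  have hB: "hermitian_mat ?m B"
    using hermitian_congruence[OF Suc.prems(2), of "mat_adjoint U"] unfolding B_def by simp
  have "A *\<^sub>v col U 0 = e \<cdot>\<^sub>v col U 0"
    using v A unfolding colU by (simp add: mult_mat_vec[of _ ?m ?m] smult_smult_assoc mult.commute)
  have "col B 0 = mat_adjoint U *\<^sub>v (A *\<^sub>v col U 0)"
    unfolding B_def using A by (simp add: assoc_mult_mat[of _ ?m ?m _ ?m _ ?m] col_mult2[of _ ?m ?m _ ?m])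
  also have "\<dots> = e \<cdot>\<^sub>v (mat_adjoint U *\<^sub>v col U 0)"
    unfolding \<open>A *\<^sub>v col U 0 = _\<close>
    by (rule mult_mat_vec[of _ ?m ?m]) (simp, rule col_carrier_vec[OF _ Uc], simp)
  also have "mat_adjoint U *\<^sub>v col U 0 = col (mat_adjoint U * U) 0"
    by (simp add: col_mult2[of _ ?m ?m _ ?m])
  finally have colB: "col B 0 = e \<cdot>\<^sub>v unit_vec ?m 0" by (simp add: UU)
  have B0: "B $$ (i, 0) = (if i = 0 then e else 0)" if "i < ?m" for i
    using arg_cong[OF colB, of "\<lambda>w. w $ i"] that Bc by simp
  \<comment> \<open>The first column is known from the eigenvector equation; Hermitian symmetry
    transfers its zeros to the first row, and next forces the eigenvalue to be real.\<close>
  have B0': "B $$ (0, i) = (if i = 0 then e else 0)" if "i < ?m" for i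
    using hermitian_index[OF hB, of 0 i] hermitian_index[OF hB, of 0 0] B0[OF that] B0[of 0] that by auto
  have e: "e = complex_of_real (Re e)"
    using hermitian_index[OF hB, of 0 0] B0[of 0] by (simp add: complex_eq_iff)
  define B' where "B' = mat n n (\<lambda>(i, j). B $$ (Suc i, Suc j))"
  have "mat_adjoint B' = B'"
    unfolding B'_def by (rule eq_matI) (auto simp flip: hermitian_index[OF hB])
  then have "hermitian_mat n B'" by (simp add: hermitian_mat_def B'_def)
  then obtain V d where V: "unitary_mat n V" and B': "B' = cdiag n V d"
    using Suc.IH by blast
  have Vc: "V \<in> carrier_mat n n" and VV: "mat_adjoint V * V = 1\<^sub>m n"
    using V by (auto simp: unitary_mat_def)
  \<comment> \<open>The block diagonal matrix with blocks 1 and \<open>V\<close>.\<close>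
  define W where "W = mat ?m ?m (\<lambda>(i, j). case (i, j) of
      (Suc k, Suc l) \<Rightarrow> V $$ (k, l) | (0, 0) \<Rightarrow> 1 | _ \<Rightarrow> 0)"
  have Wc: "W \<in> carrier_mat ?m ?m" unfolding W_def by simp
  have W [simp]: "W $$ (0, 0) = 1" "k < n \<Longrightarrow> W $$ (0, Suc k) = 0" "k < n \<Longrightarrow> W $$ (Suc k, 0) = 0"
    "k < n \<Longrightarrow> l < n \<Longrightarrow> W $$ (Suc k, Suc l) = V $$ (k, l)" for k l
    unfolding W_def by auto
  have "unitary_mat ?m W"
  proof (rule unitary_matI[OF Wc], rule eq_matI)
    fix i j assume "i < dim_row (1\<^sub>m ?m :: complex mat)" "j < dim_col (1\<^sub>m ?m :: complex mat)"
    then have ij: "i < ?m" "j < ?m" by auto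
    have VV': "(\<Sum>k<n. cnj (V $$ (k, i)) * V $$ (k, j)) = (if i = j then 1 else 0)"
      if "i < n" "j < n" for i j
      using arg_cong[OF VV, of "\<lambda>M. M $$ (i, j)"] that Vc
      by (simp add: scalar_prod_def atLeast0LessThan)
    have "(mat_adjoint W * W) $$ (i, j) = (\<Sum>k<?m. cnj (W $$ (k, i)) * W $$ (k, j))"
      using Wc ij by (simp add: scalar_prod_def atLeast0LessThan)
    also have "\<dots> = (if i = j then 1 else 0)"
      using ij by (cases i; cases j) (simp_all add: sum.lessThan_Suc_shift VV' del: sum.lessThan_Suc)
    finally show "(mat_adjoint W * W) $$ (i, j) = 1\<^sub>m ?m $$ (i, j)" using ij by simp
  qed (use Wc in auto)
  define d' where "d' = case_nat (Re e) d"
  have "B = cdiag ?m W d'"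
  proof (rule eq_matI)
    fix i j assume "i < dim_row (cdiag ?m W d')" "j < dim_col (cdiag ?m W d')"
    then have ij: "i < ?m" "j < ?m" using carrier_matD[OF cdiag_carrier[OF Wc]] by auto
    have BV: "B $$ (Suc k, Suc l) = (\<Sum>q<n. V $$ (k, q) * d q * cnj (V $$ (l, q)))"
      if "k < n" "l < n" for k l
      using arg_cong[OF B', of "\<lambda>M. M $$ (k, l)"] that Vc by (simp add: cdiag_index B'_def)
    show "B $$ (i, j) = cdiag ?m W d' $$ (i, j)"
      using ij e unfolding cdiag_index[OF Wc ij] d'_def
      by (cases i; cases j)
        (simp_all add: sum.lessThan_Suc_shift B0 B0' BV del: sum.lessThan_Suc)
  qed (use Bc carrier_matD[OF cdiag_carrier[OF Wc]] in auto)
  then have "A = cdiag ?m (U * W) d'"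
    using cdiag_unitary_conj[OF U A Wc] unfolding B_def by simp
  then show ?case using Suc.prems(1) unitary_mat_mult[OF U \<open>unitary_mat ?m W\<close>] by blast
qed

text \<open>The matrix \<open>W = mat_adjoint V * U\<close> intertwines the two diagonals, so its
  entry at \<open>(i, j)\<close> can be nonzero only where \<open>e i = d j\<close>. There
  \<open>f (e i) = f (d j)\<close>, hence \<open>W\<close> also intertwines the diagonals of values
  of \<open>f\<close>.\<close>

lemma cdiag_fun_unique:
  assumes U: "unitary_mat n U" and V: "unitary_mat n V" and eq: "cdiag n U d = cdiag n V e"
  shows "cdiag n U (\<lambda>i. f (d i)) = cdiag n V (\<lambda>i. f (e i))"
proof -
  have [simp]: "U \<in> carrier_mat n n" "V \<in> carrier_mat n n"
    and UU: "mat_adjoint U * U = 1\<^sub>m n" "U * mat_adjoint U = 1\<^sub>m n"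
    and VV: "mat_adjoint V * V = 1\<^sub>m n" "V * mat_adjoint V = 1\<^sub>m n"
    using U V by (auto simp: unitary_mat_def)
  define W where "W = mat_adjoint V * U"
  have W [simp]: "W \<in> carrier_mat n n" unfolding W_def by simp
  have move: "mat_adjoint V * cdiag n U a * U = W * mat_diag n (\<lambda>i. complex_of_real (a i))" for a
    unfolding cdiag_def W_def
    by (simp add: assoc_mult_mat[of _ n n _ n _ n] UU)
  have move': "mat_adjoint V * cdiag n V a * U = mat_diag n (\<lambda>i. complex_of_real (a i)) * W" for a
  proof -
    have "mat_adjoint V * cdiag n V a * U
        = (mat_adjoint V * V) * (mat_diag n (\<lambda>i. complex_of_real (a i)) * W)"
      unfolding cdiag_def W_def by (simp add: assoc_mult_mat[of _ n n _ n _ n])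
    then show ?thesis by (simp add: VV left_mult_one_mat[of _ n n])
  qed
  have "W * mat_diag n (\<lambda>i. complex_of_real (d i)) = mat_diag n (\<lambda>i. complex_of_real (e i)) * W"
    using move[of d] move'[of e] eq by simp
  then have entries: "W $$ (i, j) * d j = e i * W $$ (i, j)" if "i < n" "j < n" for i j
    using that unfolding mat_diag_mult_right[OF W] mat_diag_mult_left[OF W]
    by (auto dest!: arg_cong[where f = "\<lambda>M. M $$ (i, j)"])
  then have "W $$ (i, j) * f (d j) = f (e i) * W $$ (i, j)" if "i < n" "j < n" for i j
    using entries[OF that] by (cases "W $$ (i, j) = 0") auto
  then have "W * mat_diag n (\<lambda>i. complex_of_real (f (d i))) = mat_diag n (\<lambda>i. complex_of_real (f (e i))) * W"
    unfolding mat_diag_mult_right[OF W] mat_diag_mult_left[OF W] by (intro eq_matI) auto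
  then have "mat_adjoint V * cdiag n U (\<lambda>i. f (d i)) * U = mat_adjoint V * cdiag n V (\<lambda>i. f (e i)) * U"
    using move[of "\<lambda>i. f (d i)"] move'[of "\<lambda>i. f (e i)"] by simp
  then have "V * (mat_adjoint V * cdiag n U (\<lambda>i. f (d i)) * U) * mat_adjoint U
      = V * (mat_adjoint V * cdiag n V (\<lambda>i. f (e i)) * U) * mat_adjoint U" by simp
  moreover have "V * (mat_adjoint V * M * U) * mat_adjoint U = M" if "M \<in> carrier_mat n n" for M
  proof -
    have "V * (mat_adjoint V * M * U) * mat_adjoint U
        = (V * mat_adjoint V) * M * (U * mat_adjoint U)"
      using that by (simp add: assoc_mult_mat[of _ n n _ n _ n])
    then show ?thesis using that by (simp add: UU VV)
  qed
  ultimately show ?thesis by simp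
qed

text \<open>Uniqueness discharges the definite description in \<open>mat_fun\<close> and leaves a
  computation rule for any given unitary diagonalization.\<close>

lemma mat_fun_cdiag:
  assumes U: "unitary_mat n U"
  shows "mat_fun f (cdiag n U d) = cdiag n U (\<lambda>i. f (d i))"
proof -
  have dim: "dim_row (cdiag n U d) = n"
    using U by (auto simp: unitary_mat_def dest: cdiag_carrier)
  show ?thesis
    unfolding mat_fun_def Let_def dim cdiag_def[symmetric]
  proof (rule the_equality)
    fix B assume "\<exists>V e. unitary_mat n V \<and> cdiag n U d = cdiag n V e \<and> B = cdiag n V (\<lambda>i. f (e i))"
    then obtain V e where "unitary_mat n V" "cdiag n U d = cdiag n V e" "B = cdiag n V (\<lambda>i. f (e i))"
      by blast
    then show "B = cdiag n U (\<lambda>i. f (d i))" using cdiag_fun_unique[OF U, of V d e f] by simp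
  qed (use U in blast)
qed

subsection \<open>Means of congruent diagonal matrices\<close>

lemma pos_def_diagonalization:
  assumes "pos_def_mat n A"
  obtains U d where "unitary_mat n U" "A = cdiag n U d" "\<And>i. i < n \<Longrightarrow> 0 < d i"
proof -
  have "hermitian_mat n A" using assms by (simp add: pos_def_mat_def)
  then obtain U d where U: "unitary_mat n U" and A: "A = cdiag n U d" by (rule hermitian_spectral)
  have "0 < d i" if "i < n" for i
    using U assms that unfolding A unitary_mat_def
    by (intro pos_def_cdiagD[of U n "mat_adjoint U"]) auto
  with U A that show ?thesis by blast
qed

lemma cdiag_unitary_mult:
  assumes "unitary_mat n U"
  shows "cdiag n U d * cdiag n U e = cdiag n U (\<lambda>i. d i * e i)"
proof -
  have [simp]: "U \<in> carrier_mat n n" and UU: "mat_adjoint U * U = 1\<^sub>m n"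
    using assms by (auto simp: unitary_mat_def)
  let ?D = "\<lambda>d. mat_diag n (\<lambda>i. complex_of_real (d i))"
  have "cdiag n U d * cdiag n U e = U * (?D d * (mat_adjoint U * U) * ?D e) * mat_adjoint U"
    unfolding cdiag_def by (simp add: assoc_mult_mat[of _ n n _ n _ n])
  also have "\<dots> = cdiag n U (\<lambda>i. d i * e i)"
    by (simp add: UU cdiag_def)
  finally show ?thesis .
qed

lemma cdiag_unitary_one: "unitary_mat n U \<Longrightarrow> cdiag n U (\<lambda>_. 1) = 1\<^sub>m n"
  by (simp add: cdiag_one unitary_mat_def)

lemma mat_adjoint_cdiag: "C \<in> carrier_mat n n \<Longrightarrow> mat_adjoint (cdiag n C d) = cdiag n C d"
  using hermitian_cdiag by (simp add: hermitian_mat_def)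

text \<open>Isolates the algebra of the square root and its inverse, so that the arguments about
  means need no spectral decomposition of \<open>A\<close>.\<close>

lemma pos_def_sqrt:
  assumes "pos_def_mat n A"
  obtains R S where "R = mat_fun sqrt A" "S = mat_fun (\<lambda>t. 1 / sqrt t) A"
    "R \<in> carrier_mat n n" "S \<in> carrier_mat n n" "mat_adjoint R = R" "mat_adjoint S = S"
    "R * R = A" "R * S = 1\<^sub>m n" "S * R = 1\<^sub>m n"
proof -
  obtain U d where U: "unitary_mat n U" and A: "A = cdiag n U d" and d: "\<And>i. i < n \<Longrightarrow> 0 < d i"
    using assms by (rule pos_def_diagonalization) blast
  have Uc: "U \<in> carrier_mat n n" using U by (simp add: unitary_mat_def)
  define R where "R = cdiag n U (\<lambda>i. sqrt (d i))"
  define S where "S = cdiag n U (\<lambda>i. 1 / sqrt (d i))"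
  have "R * R = A"
    unfolding R_def A cdiag_unitary_mult[OF U] using d by (intro cdiag_cong) (simp add: less_imp_le)
  moreover have "cdiag n U (\<lambda>i. sqrt (d i) * (1 / sqrt (d i))) = cdiag n U (\<lambda>_. 1)"
    using d by (intro cdiag_cong) (simp add: less_imp_neq[symmetric])
  then have "R * S = 1\<^sub>m n" "S * R = 1\<^sub>m n"
    unfolding R_def S_def cdiag_unitary_mult[OF U]
    by (simp_all add: cdiag_unitary_one[OF U] mult.commute)
  moreover have "R \<in> carrier_mat n n" "S \<in> carrier_mat n n" "mat_adjoint R = R" "mat_adjoint S = S"
    unfolding R_def S_def using Uc by (simp_all add: mat_adjoint_cdiag)
  moreover have "R = mat_fun sqrt A" "S = mat_fun (\<lambda>t. 1 / sqrt t) A"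
    unfolding R_def S_def A mat_fun_cdiag[OF U] by simp_all
  ultimately show ?thesis using that by blast
qed

text \<open>A polar decomposition: with \<open>R\<close> the square root of
  \<open>A = C * mat_adjoint C\<close> and \<open>S\<close> its inverse, \<open>W = S * C\<close> is
  unitary. Hence \<open>S * cdiag n C e * S = cdiag n W e\<close> is already diagonalized, and
  multiplying back uses \<open>R * W = C\<close>.\<close>

lemma mean_of_fun_self_adjoint_product:
  assumes C: "C \<in> carrier_mat n n" and D: "D \<in> carrier_mat n n" and DC: "D * C = 1\<^sub>m n"
  shows "mean_of_fun f (C * mat_adjoint C) (cdiag n C e) = cdiag n C (\<lambda>i. f (e i))"
proof -
  define A where "A = C * mat_adjoint C"
  have "pos_def_mat n A"
    unfolding A_def cdiag_one[OF C, symmetric] by (rule pos_def_cdiag[OF C D DC]) simp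
  then obtain R S where R: "R = mat_fun sqrt A" and S: "S = mat_fun (\<lambda>t. 1 / sqrt t) A"
    and [simp]: "R \<in> carrier_mat n n" "S \<in> carrier_mat n n"
    and adj: "mat_adjoint R = R" "mat_adjoint S = S"
    and RR: "R * R = A" and RS: "R * S = 1\<^sub>m n" and SR: "S * R = 1\<^sub>m n"
    by (rule pos_def_sqrt)
  define W where "W = S * C"
  have [simp]: "W \<in> carrier_mat n n" unfolding W_def using C by simp
  have "W * mat_adjoint W = S * A * S"
    unfolding W_def A_def using C
    by (simp add: mat_adjoint_mult[of _ n n _ n] adj assoc_mult_mat[of _ n n _ n _ n])
  also have "\<dots> = (S * R) * (R * S)"
    unfolding RR[symmetric] by (simp add: assoc_mult_mat[of _ n n _ n _ n])
  finally have "W * mat_adjoint W = 1\<^sub>m n" by (simp add: RS SR)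
  then have W: "unitary_mat n W"
    using mat_mult_left_right_inverse[of W n "mat_adjoint W"] by (simp add: unitary_matI)
  have "mean_of_fun f A (cdiag n C e) = R * mat_fun f (S * cdiag n C e * S) * R"
    unfolding mean_of_fun_def Let_def R S ..
  also have "S * cdiag n C e * S = cdiag n W e"
    using cdiag_mult[of S n C e] C unfolding W_def adj by simp
  also have "R * mat_fun f (cdiag n W e) * R = cdiag n (R * W) (\<lambda>i. f (e i))"
    using cdiag_mult[of R n W] unfolding mat_fun_cdiag[OF W] adj by simp
  also have "R * W = (R * S) * C"
    unfolding W_def using C by (simp add: assoc_mult_mat[of _ n n _ n _ n])
  finally show ?thesis using C by (simp add: RS A_def)
qed

text \<open>Scaling the columns of \<open>C\<close> by the square roots of \<open>a\<close> turns
  the first argument into \<open>C' * mat_adjoint C'\<close> and the second diagonal into the ratios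
  \<open>b i / a i\<close>, which reduces the claim to the preceding lemma.\<close>

lemma mean_of_fun_congruence:
  assumes C: "C \<in> carrier_mat n n" and D: "D \<in> carrier_mat n n" and DC: "D * C = 1\<^sub>m n"
    and a: "\<And>i. i < n \<Longrightarrow> 0 < a i"
  shows "mean_of_fun f (cdiag n C a) (cdiag n C b) = cdiag n C (\<lambda>i. a i * f (b i / a i))"
proof -
  define r where "r i = sqrt (a i)" for i
  have r: "r i \<noteq> 0" "r i * r i = a i" if "i < n" for i
    using a[OF that] unfolding r_def by auto
  define K where "K = mat_diag n (\<lambda>i. complex_of_real (r i))"
  define L where "L = mat_diag n (\<lambda>i. complex_of_real (1 / r i))"
  have KL [simp]: "K \<in> carrier_mat n n" "L \<in> carrier_mat n n" unfolding K_def L_def by simp_all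
  have LK: "L * K = 1\<^sub>m n"
    unfolding L_def K_def mat_diag_diag
    using r by (auto intro!: eq_matI simp: mat_diag_def simp flip: of_real_mult)
  define C' where "C' = C * K"
  have C': "C' \<in> carrier_mat n n" unfolding C'_def using C by simp
  have "L * D * C' = L * (D * C) * K"
    unfolding C'_def using C D by (simp add: assoc_mult_mat[of _ n n _ n _ n])
  then have D': "L * D \<in> carrier_mat n n" "L * D * C' = 1\<^sub>m n" using D by (simp_all add: DC LK)
  have scale: "cdiag n C' x = cdiag n C (\<lambda>i. a i * x i)" for x
    unfolding C'_def K_def cdiag_scale[OF C]
    by (rule cdiag_cong) (simp add: r(2)[symmetric] ac_simps)
  have A: "cdiag n C a = C' * mat_adjoint C'"
    unfolding cdiag_one[OF C', symmetric] scale by simp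
  have B: "cdiag n C b = cdiag n C' (\<lambda>i. b i / a i)"
    unfolding scale by (rule cdiag_cong) (use a in \<open>simp add: less_imp_neq[symmetric]\<close>)
  show ?thesis
    unfolding A B mean_of_fun_self_adjoint_product[OF C' D'] by (rule scale)
qed

text \<open>With \<open>R\<close> the square root of \<open>X\<close> and \<open>S\<close> its
  inverse, diagonalize \<open>S * Y * S\<close> by a unitary \<open>V\<close> and take
  \<open>C = R * V\<close>; unitarity of \<open>V\<close> keeps
  \<open>X = C * mat_adjoint C\<close>.\<close>

lemma simultaneous_diagonalization:
  assumes X: "pos_def_mat n X" and Y: "hermitian_mat n Y"
  obtains C D z where "C \<in> carrier_mat n n" "D \<in> carrier_mat n n" "D * C = 1\<^sub>m n"
    "X = cdiag n C (\<lambda>_. 1)" "Y = cdiag n C z"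
proof -
  obtain R S where [simp]: "R \<in> carrier_mat n n" "S \<in> carrier_mat n n"
    and adj: "mat_adjoint R = R" "mat_adjoint S = S"
    and RR: "R * R = X" and RS: "R * S = 1\<^sub>m n" and SR: "S * R = 1\<^sub>m n"
    using X by (rule pos_def_sqrt)
  have Yc: "Y \<in> carrier_mat n n" using Y by (simp add: hermitian_mat_def)
  have "hermitian_mat n (S * Y * S)" using hermitian_congruence[OF Y, of S] by (simp add: adj)
  then obtain V z where V: "unitary_mat n V" and Z: "S * Y * S = cdiag n V z"
    by (rule hermitian_spectral)
  have Vc [simp]: "V \<in> carrier_mat n n" and VV: "mat_adjoint V * V = 1\<^sub>m n" "V * mat_adjoint V = 1\<^sub>m n"
    using V by (auto simp: unitary_mat_def)
  have "(mat_adjoint V * S) * (R * V) = mat_adjoint V * (S * R) * V"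
    by (simp add: assoc_mult_mat[of _ n n _ n _ n])
  also have "\<dots> = 1\<^sub>m n" by (simp add: SR VV)
  finally have inv: "(mat_adjoint V * S) * (R * V) = 1\<^sub>m n" .
  have "X = R * cdiag n V (\<lambda>_. 1) * mat_adjoint R"
    unfolding cdiag_unitary_one[OF V] by (simp add: adj RR)
  then have X': "X = cdiag n (R * V) (\<lambda>_. 1)" by (simp add: cdiag_mult)
  have "Y = (R * S) * Y * (S * R)" using Yc by (simp add: RS SR)
  also have "\<dots> = R * (S * Y * S) * R" using Yc by (simp add: assoc_mult_mat[of _ n n _ n _ n])
  also have "\<dots> = cdiag n (R * V) z" unfolding Z using cdiag_mult[of R n V z] by (simp add: adj)
  finally show ?thesis using that[OF _ _ inv X'] by simp
qed

subsection \<open>The Loewner order\<close>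

lemma quad_form_diff:
  fixes A B :: "complex mat"
  assumes "A \<in> carrier_mat n n" "B \<in> carrier_mat n n" "v \<in> carrier_vec n"
  shows "((A - B) *\<^sub>v v) \<bullet>c v = (A *\<^sub>v v) \<bullet>c v - (B *\<^sub>v v) \<bullet>c v"
  using assms by (simp add: minus_mult_distrib_mat_vec minus_scalar_prod_distrib[of _ n])

text \<open>Comparing quadratic forms pointwise makes transitivity and the comparison of diagonal
  entries immediate.\<close>

lemma loewner_le_quad_form:
  "loewner_le n A B \<longleftrightarrow> hermitian_mat n A \<and> hermitian_mat n B \<and>
     (\<forall>v\<in>carrier_vec n. Re ((A *\<^sub>v v) \<bullet>c v) \<le> Re ((B *\<^sub>v v) \<bullet>c v))"
proof -
  have "hermitian_mat n (B - A)" if "hermitian_mat n A" "hermitian_mat n B"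
  proof -
    have c: "A \<in> carrier_mat n n" "B \<in> carrier_mat n n"
      using that by (auto simp: hermitian_mat_def)
    have "mat_adjoint (B - A) = B - A"
      by (rule eq_matI) (use c in \<open>auto simp flip: hermitian_index[OF that(1)] hermitian_index[OF that(2)]\<close>)
    then show ?thesis using c by (simp add: hermitian_mat_def minus_carrier_mat)
  qed
  then show ?thesis
    unfolding loewner_le_def pos_semidef_mat_def
    by (auto simp: quad_form_diff[of _ n] hermitian_mat_def)
qed

lemma loewner_le_trans: "loewner_le n A B \<Longrightarrow> loewner_le n B C \<Longrightarrow> loewner_le n A C"
  unfolding loewner_le_quad_form by force

lemma loewner_le_diag_entry:
  assumes "loewner_le n A B" "i < n"
  shows "Re (A $$ (i, i)) \<le> Re (B $$ (i, i))"
proof -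
  have "(M *\<^sub>v unit_vec n i) \<bullet>c unit_vec n i = M $$ (i, i)" if "M \<in> carrier_mat n n" for M :: "complex mat"
  proof -
    have "(M *\<^sub>v unit_vec n i) \<bullet>c unit_vec n i
        = (\<Sum>k<n. \<Sum>l<n. if l = i then (if k = i then M $$ (k, l) else 0) else 0)"
      unfolding quad_form[OF that unit_vec_carrier] using assms(2) by (intro sum.cong) auto
    then show ?thesis using assms(2) by simp
  qed
  moreover have "A \<in> carrier_mat n n" "B \<in> carrier_mat n n"
    using assms(1) by (auto simp: loewner_le_def hermitian_mat_def)
  ultimately show ?thesis
    using assms unfolding loewner_le_quad_form by (metis unit_vec_carrier)
qed

text \<open>The difference is again of the form \<open>cdiag n C d\<close>, so the sign criteria for
  invertible \<open>C\<close> apply.\<close>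

lemma loewner_le_cdiag:
  assumes "C \<in> carrier_mat n n" "D \<in> carrier_mat n n" "D * C = 1\<^sub>m n"
  shows "loewner_le n (cdiag n C a) (cdiag n C b) \<longleftrightarrow> (\<forall>i<n. a i \<le> b i)"
  using pos_semidef_cdiag[OF assms(1), of "\<lambda>i. b i - a i"] pos_semidef_cdiagD[OF assms, of _ "\<lambda>i. b i - a i"]
  unfolding loewner_le_def cdiag_diff[OF assms(1)] by (auto simp: hermitian_cdiag assms(1))

lemma cdiag_real_index:
  assumes "i < n" "j < n"
  shows "cdiag n (mat n n (\<lambda>(i, j). complex_of_real (u i j))) d $$ (i, j)
       = complex_of_real (\<Sum>k<n. u i k * d k * u j k)"
  using assms by (subst cdiag_index) auto

subsection \<open>Symmetric operator monotone functions\<close>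

text \<open>The case of \<open>1 x 1\<close> matrices.\<close>

lemma operator_monotone_mono:
  assumes "operator_monotone f" "0 < x" "x \<le> y"
  shows "f x \<le> f y"
proof -
  let ?I = "1\<^sub>m 1 :: complex mat"
  have I: "?I \<in> carrier_mat 1 1" "?I * ?I = 1\<^sub>m 1" by simp_all
  have "loewner_le 1 (mat_fun f (cdiag 1 ?I (\<lambda>_. x))) (mat_fun f (cdiag 1 ?I (\<lambda>_. y)))"
    using assms pos_def_cdiag[OF I(1) I, of "\<lambda>_. x"] pos_def_cdiag[OF I(1) I, of "\<lambda>_. y"]
      loewner_le_cdiag[OF I(1) I, of "\<lambda>_. x" "\<lambda>_. y"]
    unfolding operator_monotone_def by simp
  then show ?thesis
    by (simp add: mat_fun_cdiag[OF unitary_mat_one] loewner_le_cdiag[OF I(1) I] del: One_nat_def)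
qed

text \<open>The unitary \<open>U\<close> is the reflection with first row proportional to \<open>(1, \<surd>t)\<close>, so that
  \<open>X = U diag(t, 1/t) U\<^sup>*\<close> has upper left entry 1 and the upper left entry of \<open>f(X)\<close> is the left hand
  side. For every \<open>e > 0\<close> there is an \<open>N\<close> with \<open>X \<le> diag(1 + e, N)\<close>.\<close>

lemma operator_monotone_concave_at_inverses:
  assumes f: "operator_monotone f" and t: "0 < t" and e: "0 < e"
  shows "f t / (1 + t) + t * f (1 / t) / (1 + t) \<le> f (1 + e)"
proof -
  define s where "s = sqrt (1 + t)"
  define q where "q = sqrt t"
  have sq: "s \<noteq> 0" "s * s = 1 + t" "q * q = t" using t by (simp_all add: s_def q_def)
  define u where "u i j = (if i = 0 \<and> j = 0 then 1 / s else if i = 1 \<and> j = 1 then - 1 / s else q / s)" for i j :: nat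
  define U where "U = mat 2 2 (\<lambda>(i, j). complex_of_real (u i j))"
  define d where "d i = (if i = 0 then t else 1 / t)" for i :: nat
  have Uc: "U \<in> carrier_mat 2 2" unfolding U_def by simp
  have two: "(\<Sum>k<2. h k) = h 0 + h 1" for h :: "nat \<Rightarrow> real"
    by (simp add: numeral_2_eq_2)
  have orth: "(\<Sum>k<2. u k i * u k j) = (if i = j then 1 else 0)" if "i < 2" "j < 2" for i j
  proof -
    have "1 / (s * s) + q * q / (s * s) = 1" using sq t by (simp flip: add_divide_distrib)
    then show ?thesis using that by (auto simp: two u_def less_2_cases_iff)
  qed
  have "mat_adjoint U * U = 1\<^sub>m 2"
  proof (rule eq_matI)
    fix i j assume "i < dim_row (1\<^sub>m 2 :: complex mat)" "j < dim_col (1\<^sub>m 2 :: complex mat)"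
    then have ij: "i < 2" "j < 2" by auto
    then have "(mat_adjoint U * U) $$ (i, j) = complex_of_real (\<Sum>k<2. u k i * u k j)"
      unfolding U_def by (simp add: scalar_prod_def atLeast0LessThan)
    then show "(mat_adjoint U * U) $$ (i, j) = 1\<^sub>m 2 $$ (i, j)"
      using ij by (simp only: orth) simp
  qed (use Uc in auto)
  with Uc have U: "unitary_mat 2 U" by (rule unitary_matI)
  define c where "c = (\<Sum>k<2. u 0 k * d k * u 1 k)"
  \<comment> \<open>Here \<open>c\<close> is the off-diagonal entry of \<open>X\<close>. The last
    summand makes the determinant of \<open>diag(1 + e, N) - X\<close> vanish, so that this
    difference has rank one.\<close>
  define N where "N = (\<Sum>k<2. u 1 k * d k * u 1 k) + c * c / e"
  define y where "y i = (if i = 0 then 1 + e else N)" for i :: nat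
  have X00: "(\<Sum>k<2. u 0 k * d k * u 0 k) = 1"
  proof -
    have "(\<Sum>k<2. u 0 k * d k * u 0 k) = t / (s * s) + (q * q) / (t * (s * s))"
      by (simp add: two u_def d_def)
    also have "\<dots> = 1" using t unfolding sq by (simp flip: add_divide_distrib)
    finally show ?thesis .
  qed
  have "0 < q * q * t / (s * s)" "0 < 1 / (t * (s * s))" using t unfolding sq by simp_all
  moreover have "N = q * q * t / (s * s) + 1 / (t * (s * s)) + c * c / e"
    by (simp add: N_def two u_def d_def ac_simps)
  moreover have "0 \<le> c * c / e" using e by simp
  ultimately have "0 < N" by linarith
  let ?I = "1\<^sub>m 2 :: complex mat"
  have I: "?I \<in> carrier_mat 2 2" "?I * ?I = 1\<^sub>m 2" by simp_all
  have diag: "cdiag 2 ?I x $$ (i, j) = complex_of_real (if i = j then x i else 0)"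
    if "i < 2" "j < 2" for x i j
    using that unfolding cdiag_def by (simp add: mat_diag_def)
  \<comment> \<open>Eliminating the off-diagonal entry \<open>-c\<close> of the difference with the
    pivot \<open>e\<close>: the first column of \<open>L\<close> is \<open>(1, -c/e)\<close>, and
    only the pivot remains in the diagonal.\<close>
  define l where "l i j = (if i = j then 1 else if i = 1 \<and> j = 0 then - c / e else 0)" for i j :: nat
  define L where "L = mat 2 2 (\<lambda>(i, j). complex_of_real (l i j))"
  define \<delta> where "\<delta> i = (if i = 0 then e else 0)" for i :: nat
  have Lc: "L \<in> carrier_mat 2 2" unfolding L_def by simp
  have "cdiag 2 ?I y - cdiag 2 U d = cdiag 2 L \<delta>"
  proof (rule eq_matI)
    fix i j assume "i < dim_row (cdiag 2 L \<delta>)" "j < dim_col (cdiag 2 L \<delta>)"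
    then have ij: "i < 2" "j < 2" using Lc by auto
    have "(if i = j then y i else 0) - (\<Sum>k<2. u i k * d k * u j k) = (\<Sum>k<2. l i k * \<delta> k * l j k)"
    proof -
      have sym: "(\<Sum>k<2. u 1 k * d k * u 0 k) = c" unfolding c_def by (simp add: ac_simps)
      have l: "(\<Sum>k<2. l i k * \<delta> k * l j k) = l i 0 * e * l j 0" by (simp add: two \<delta>_def)
      show ?thesis unfolding l
        using ij e X00 sym c_def[symmetric]
        by (auto simp: less_2_cases_iff y_def N_def l_def simp del: One_nat_def)
    qed
    moreover have "(cdiag 2 ?I y - cdiag 2 U d) $$ (i, j)
        = complex_of_real ((if i = j then y i else 0) - (\<Sum>k<2. u i k * d k * u j k))"
      using ij Uc cdiag_real_index[OF ij, of u d] diag[OF ij, of y] unfolding U_def by simp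
    moreover have "cdiag 2 L \<delta> $$ (i, j) = complex_of_real (\<Sum>k<2. l i k * \<delta> k * l j k)"
      using cdiag_real_index[OF ij, of l \<delta>] unfolding L_def by simp
    ultimately show "(cdiag 2 ?I y - cdiag 2 U d) $$ (i, j) = cdiag 2 L \<delta> $$ (i, j)" by metis
  qed (use Uc Lc in auto)
  then have "pos_semidef_mat 2 (cdiag 2 ?I y - cdiag 2 U d)"
    using pos_semidef_cdiag[OF Lc, of \<delta>] e by (simp add: \<delta>_def)
  then have "loewner_le 2 (cdiag 2 U d) (cdiag 2 ?I y)"
    unfolding loewner_le_def using Uc by (simp add: hermitian_cdiag)
  moreover have "pos_def_mat 2 (cdiag 2 U d)"
    using U t by (intro pos_def_cdiag[of U 2 "mat_adjoint U"]) (auto simp: unitary_mat_def d_def)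
  moreover have "pos_def_mat 2 (cdiag 2 ?I y)"
    using \<open>0 < N\<close> e by (intro pos_def_cdiag[OF I(1) I]) (simp add: y_def)
  ultimately have "loewner_le 2 (mat_fun f (cdiag 2 U d)) (mat_fun f (cdiag 2 ?I y))"
    using f unfolding operator_monotone_def by blast
  then have "Re (cdiag 2 U (\<lambda>i. f (d i)) $$ (0, 0)) \<le> Re (cdiag 2 ?I (\<lambda>i. f (y i)) $$ (0, 0))"
    unfolding mat_fun_cdiag[OF U] mat_fun_cdiag[OF unitary_mat_one] by (rule loewner_le_diag_entry) simp
  then have "(\<Sum>k<2. u 0 k * f (d k) * u 0 k) \<le> f (y 0)"
    unfolding U_def by (subst (asm) cdiag_real_index) (simp_all add: diag)
  moreover have "(\<Sum>k<2. u 0 k * f (d k) * u 0 k) = f t / (s * s) + (q * q) * f (1 / t) / (s * s)"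
    by (simp add: two u_def d_def)
  ultimately show ?thesis unfolding sq by (simp add: y_def)
qed

lemma F_op_mono: "f \<in> F_op \<Longrightarrow> 0 < x \<Longrightarrow> x \<le> y \<Longrightarrow> f x \<le> f y"
  by (rule operator_monotone_mono) (auto simp: F_op_def)

text \<open>By the symmetry \<open>t * f (1 / t) = f t\<close>, monotonicity of \<open>f\<close>
  says that \<open>f t / t\<close> is decreasing.\<close>

lemma F_op_upper:
  assumes f: "f \<in> F_op" and "0 < x" "x \<le> y"
  shows "f y \<le> y / x * f x"
proof -
  have "y * f (1 / y) \<le> y * f (1 / x)"
    using assms by (intro mult_left_mono F_op_mono[OF f]) (auto simp: frac_le)
  moreover have "y * f (1 / y) = f y" "x * f (1 / x) = f x"
    using assms by (auto simp: F_op_def)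
  ultimately show ?thesis using assms by (metis less_irrefl nonzero_mult_div_cancel_left times_divide_eq_left mult.commute)
qed

text \<open>By symmetry both summands of the \<open>2 x 2\<close> inequality equal
  \<open>f t / (1 + t)\<close>. Its right hand side is at most \<open>1 + e\<close>, because
  \<open>f 1 = 1\<close> and \<open>f\<close> grows at most linearly from there; then let
  \<open>e\<close> tend to 0.\<close>

lemma F_op_le_arithmetic:
  assumes f: "f \<in> F_op" and t: "0 < t"
  shows "f t \<le> (1 + t) / 2"
proof -
  have "f t * 2 / (1 + t) \<le> 1"
  proof (rule field_le_epsilon)
    fix e :: real assume e: "0 < e"
    have "f t / (1 + t) + t * f (1 / t) / (1 + t) \<le> f (1 + e)"
      using f t e by (intro operator_monotone_concave_at_inverses) (auto simp: F_op_def)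
    also have "\<dots> \<le> (1 + e) / 1 * f 1" using e by (intro F_op_upper[OF f]) auto
    finally show "f t * 2 / (1 + t) \<le> 1 + e" using f t by (simp add: F_op_def mult.commute)
  qed
  then show ?thesis using t by (simp add: field_simps)
qed

text \<open>Apply the arithmetic bound to the function that witnesses \<open>preceq_op\<close> and
  cancel \<open>(t + 1) / 2\<close>.\<close>

lemma preceq_op_le:
  assumes "preceq_op f g" and t: "0 < t"
  shows "f t \<le> g t"
proof -
  have "0 < g t" and F: "(\<lambda>t. (t + 1) / 2 * (f t / g t)) \<in> F_op"
    using assms by (auto simp: preceq_op_def F_op_def)
  have "(t + 1) / 2 * (f t / g t) \<le> (t + 1) / 2 * 1"
    using F_op_le_arithmetic[OF F t] by (simp add: add.commute)
  then have "f t / g t \<le> 1" by (rule mult_left_le_imp_le) (use t in simp)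
  then show ?thesis using \<open>0 < g t\<close> by simp
qed

section \<open>Continuity and the values of \<open>f s / sqrt s\<close>\<close>

text \<open>Since \<open>f\<close> increases and \<open>f t / t\<close> decreases,
  \<open>f y\<close> lies between \<open>f x\<close> and \<open>y / x * f x\<close>; both bounds
  tend to \<open>f x\<close>.\<close>

lemma F_op_continuous_on:
  assumes f: "f \<in> F_op"
  shows "continuous_on {0<..} f"
  unfolding continuous_on_def
proof
  fix x :: real assume "x \<in> {0<..}"
  then have x: "0 < x" by simp
  have bounds: "min 1 (y / x) * f x \<le> f y \<and> f y \<le> max 1 (y / x) * f x" if y: "0 < y" for y
  proof (cases "x \<le> y")
    case True
    then have "f x \<le> f y" "f y \<le> y / x * f x" "1 \<le> y / x"
      using F_op_mono[OF f x] F_op_upper[OF f x] x by auto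
    then show ?thesis by (simp add: min_absorb1 max_absorb2)
  next
    case False
    then have "f y \<le> f x" "f x \<le> x / y * f y" "y / x \<le> 1"
      using F_op_mono[OF f y] F_op_upper[OF f y] x y by auto
    then show ?thesis using x y by (simp add: min_absorb2 max_absorb1 field_simps)
  qed
  have ev: "\<forall>\<^sub>F y in at x within {0<..}. 0 < y"
    by (simp add: eventually_at_filter)
  have "((\<lambda>y. min 1 (y / x) * f x) \<longlongrightarrow> min 1 (x / x) * f x) (at x within {0<..})"
    "((\<lambda>y. max 1 (y / x) * f x) \<longlongrightarrow> max 1 (x / x) * f x) (at x within {0<..})"
    by (intro tendsto_intros; use x in simp)+
  then have lim: "((\<lambda>y. min 1 (y / x) * f x) \<longlongrightarrow> f x) (at x within {0<..})"
    "((\<lambda>y. max 1 (y / x) * f x) \<longlongrightarrow> f x) (at x within {0<..})"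
    using x by simp_all
  show "(f \<longlongrightarrow> f x) (at x within {0<..})"
    by (rule tendsto_sandwich[OF _ _ lim]) (use bounds in \<open>auto intro: eventually_mono[OF ev]\<close>)
qed

text \<open>Intermediate values between 1, taken at \<open>s = 1\<close>, and the value at
  \<open>t\<close>. The two alternatives for \<open>r\<close> serve the two parts of the
  theorem.\<close>

lemma F_op_ratio_attains:
  assumes f: "f \<in> F_op" and t: "0 < t"
    and r: "1 \<le> r \<and> r \<le> f t / sqrt t \<or> f t / sqrt t \<le> r \<and> r \<le> 1"
  obtains s where "0 < s" "f s / sqrt s = r"
proof -
  let ?S = "(\<lambda>s. f s / sqrt s) ` {0<..}"
  have "continuous_on {0<..} (\<lambda>s. f s / sqrt s)"
    using F_op_continuous_on[OF f] by (auto intro!: continuous_intros)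
  then have conn: "connected ?S"
    by (rule connected_continuous_image) simp
  have "f 1 / sqrt 1 \<in> ?S" by (rule imageI) simp
  then have one: "1 \<in> ?S" using f by (simp add: F_op_def)
  have "f t / sqrt t \<in> ?S" using t by auto
  then have "r \<in> ?S"
    using r connected_contains_Icc[OF conn one] connected_contains_Icc[OF conn _ one] by fastforce
  then show ?thesis using that by auto
qed

text \<open>The predicate \<open>ach_rep f\<close> sees only the values of \<open>f\<close> on the
  positive axis. If \<open>f\<close> and \<open>g\<close> agree there, both choices are made from
  the same predicate and coincide, so the exceptional set is empty.\<close>

lemma prec_op_neq:
  assumes "prec_op f g"
  obtains t where "0 < t" "f t \<noteq> g t"
proof (rule ccontr)
  assume "\<not> thesis"
  with that have "f t = g t" if "0 < t" for t using \<open>0 < t\<close> by blast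
  then have "ach_rep f = ach_rep g" unfolding ach_rep_def by (intro ext) auto
  then have "ach_fun f = ach_fun g" by (simp add: ach_fun_def)
  then show False using assms by (simp add: prec_op_def)
qed

section \<open>From bounded steps to operator monotonicity\<close>

text \<open>After simultaneous diagonalization the passage from \<open>X\<close> to \<open>Y\<close>
  raises the diagonal from 1 to \<open>z\<close>. It is cut into finitely many steps, each raising
  every entry by a factor of at most \<open>c\<close>.\<close>

lemma operator_monotoneI_local:
  assumes c: "1 < c"
    and local_mono: "\<And>n C D z z'. C \<in> carrier_mat n n \<Longrightarrow> D \<in> carrier_mat n n \<Longrightarrow> D * C = 1\<^sub>m n \<Longrightarrow>
      (\<And>i. i < n \<Longrightarrow> 0 < z i \<and> z i \<le> z' i \<and> z' i \<le> c * z i) \<Longrightarrow>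
      loewner_le n (mat_fun g (cdiag n C z)) (mat_fun g (cdiag n C z'))"
  shows "operator_monotone g"
  unfolding operator_monotone_def
proof (intro allI impI; elim conjE)
  fix n X Y assume X: "pos_def_mat n X" and Y: "pos_def_mat n Y" and le: "loewner_le n X Y"
  have "hermitian_mat n Y" using Y by (simp add: pos_def_mat_def)
  with X obtain C D z where C: "C \<in> carrier_mat n n" "D \<in> carrier_mat n n" "D * C = 1\<^sub>m n"
    and Xe: "X = cdiag n C (\<lambda>_. 1)" and Ye: "Y = cdiag n C z"
    by (rule simultaneous_diagonalization)
  have z: "1 \<le> z i" if "i < n" for i using le that unfolding Xe Ye loewner_le_cdiag[OF C] by simp
  have chain: "loewner_le n (mat_fun g (cdiag n C a)) (mat_fun g (cdiag n C b))"
    if "\<And>i. i < n \<Longrightarrow> 0 < a i \<and> a i \<le> b i \<and> b i \<le> c ^ m * a i" for m a b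
    using that
  proof (induction m arbitrary: a)
    \<comment> \<open>The bounds force \<open>a\<close> and \<open>b\<close> to agree. A local step
      is still used, as reflexivity of \<open>loewner_le\<close> requires the value of
      \<open>mat_fun g\<close> to be Hermitian.\<close>
    case 0
    have "b i \<le> c * a i" if "i < n" for i
    proof -
      have "b i = 1 * a i" using 0[OF that] by simp
      also have "\<dots> \<le> c * a i" using c 0[OF that] by (intro mult_right_mono) auto
      finally show ?thesis .
    qed
    then show ?case using 0 by (intro local_mono[OF C]) auto
  next
    case (Suc m)
    \<comment> \<open>Each entry moves as far as one step permits but stops at its target; the
      remaining factor is then at most \<open>c ^ m\<close>.\<close>
    define w where "w i = min (b i) (c * a i)" for i
    have *: "a i \<le> c * a i" "c ^ m * b i \<ge> b i" if "i < n" for i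
    proof -
      show "a i \<le> c * a i" using c Suc.prems[OF that] by simp
      have "1 \<le> c ^ m" using c by (simp add: one_le_power)
      then show "c ^ m * b i \<ge> b i"
        using Suc.prems[OF that] mult_right_mono[of 1 "c ^ m" "b i"] by simp
    qed
    have "loewner_le n (mat_fun g (cdiag n C a)) (mat_fun g (cdiag n C w))"
      using Suc.prems * by (intro local_mono[OF C]) (auto simp: w_def)
    moreover have "loewner_le n (mat_fun g (cdiag n C w)) (mat_fun g (cdiag n C b))"
    proof (rule Suc.IH)
      fix i assume i: "i < n"
      show "0 < w i \<and> w i \<le> b i \<and> b i \<le> c ^ m * w i"
        using Suc.prems[OF i] *[OF i] c by (auto simp: w_def min_def ac_simps)
    qed
    ultimately show ?case by (rule loewner_le_trans)
  qed
  \<comment> \<open>The sum bounds all entries at once, and the choice also makes sense for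
    \<open>n = 0\<close>.\<close>
  obtain m where m: "(\<Sum>i<n. z i) < c ^ m" using real_arch_pow[OF c] by blast
  have "z i \<le> c ^ m * 1" if "i < n" for i
  proof -
    have "z i \<le> (\<Sum>i<n. z i)" using that z by (intro member_le_sum) (auto intro: order_trans[of 0 1])
    with m show ?thesis by simp
  qed
  then show "loewner_le n (mat_fun g X) (mat_fun g Y)"
    unfolding Xe Ye using z by (intro chain[of _ _ m]) auto
qed

theorem theorem7:
  fixes \<sigma> :: "complex mat \<Rightarrow> complex mat \<Rightarrow> complex mat"
    and f g :: "real \<Rightarrow> real"
  assumes "operator_mean \<sigma> f"
    and "symmetric_mean \<sigma>"
  shows "(prec_op sqrt f \<and>
            (\<forall>n A B. pos_def_mat n A \<and> pos_def_mat n B \<longrightarrow>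
               loewner_le n (mat_fun g (geometric_mean A B)) (mat_fun g (\<sigma> A B)))
          \<longrightarrow> operator_monotone g)
       \<and> (prec_op f sqrt \<and>
            (\<forall>n A B. pos_def_mat n A \<and> pos_def_mat n B \<longrightarrow>
               loewner_le n (mat_fun g (\<sigma> A B)) (mat_fun g (geometric_mean A B)))
          \<longrightarrow> operator_monotone g)"
proof -
  \<comment> \<open>Shared by both parts: prescribed diagonals \<open>z\<close> and
    \<open>z'\<close> are realized by the two means of one pair, provided that each ratio
    \<open>z' i / z i\<close> lies between 1 and \<open>f t / sqrt t\<close>. The ratio determines
    \<open>s i\<close>, and then \<open>z\<close> fixes \<open>a\<close> and
    \<open>b\<close>.\<close>
  have attained: "\<exists>A B. pos_def_mat n A \<and> pos_def_mat n B \<and>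
      geometric_mean A B = cdiag n C z \<and> \<sigma> A B = cdiag n C z'"
    if f: "f \<in> F_op" and t: "0 < t" and C: "C \<in> carrier_mat n n" "D \<in> carrier_mat n n" "D * C = 1\<^sub>m n"
      and z: "\<And>i. i < n \<Longrightarrow> 0 < z i"
      and r: "\<And>i. i < n \<Longrightarrow> 1 \<le> z' i / z i \<and> z' i / z i \<le> f t / sqrt t \<or>
        f t / sqrt t \<le> z' i / z i \<and> z' i / z i \<le> 1"
    for n t z z' and C D :: "complex mat"
  proof -
    have "\<exists>s>0. f s / sqrt s = z' i / z i" if "i < n" for i
      using F_op_ratio_attains[OF f t r[OF that]] by blast
    then obtain s where s: "\<And>i. i < n \<Longrightarrow> 0 < s i" "\<And>i. i < n \<Longrightarrow> f (s i) / sqrt (s i) = z' i / z i"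
      by metis
    define a where "a i = z i / sqrt (s i)" for i
    define b where "b i = z i * sqrt (s i)" for i
    have a: "0 < a i" and b: "0 < b i" and ratio: "b i / a i = s i"
      and z_eq: "a i * sqrt (s i) = z i" and z'_eq: "a i * f (s i) = z' i" if "i < n" for i
    proof -
      show "0 < a i" "0 < b i" "a i * sqrt (s i) = z i" "b i / a i = s i"
        using z[OF that] s(1)[OF that] by (simp_all add: a_def b_def)
      have "a i * f (s i) = z i * (f (s i) / sqrt (s i))" by (simp add: a_def)
      then show "a i * f (s i) = z' i" using z[OF that] s(2)[OF that] by simp
    qed
    have pd: "pos_def_mat n (cdiag n C a)" "pos_def_mat n (cdiag n C b)"
      using a b by (auto intro: pos_def_cdiag[OF C])
    have "mean_of_fun h (cdiag n C a) (cdiag n C b) = cdiag n C (\<lambda>i. a i * h (s i))" for h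
      by (subst mean_of_fun_congruence[OF C]) (use a ratio in \<open>auto intro: cdiag_cong\<close>)
    moreover have "cdiag n C (\<lambda>i. a i * sqrt (s i)) = cdiag n C z"
      "cdiag n C (\<lambda>i. a i * f (s i)) = cdiag n C z'"
      by (simp_all add: z_eq z'_eq cong: cdiag_cong)
    moreover have "\<sigma> (cdiag n C a) (cdiag n C b) = mean_of_fun f (cdiag n C a) (cdiag n C b)"
      using assms(1) pd unfolding operator_mean_def by blast
    ultimately show ?thesis using pd unfolding geometric_mean_def by metis
  qed
  show ?thesis
  proof (intro conjI impI; elim conjE)
    assume prec: "prec_op sqrt f" and H: "\<forall>n A B. pos_def_mat n A \<and> pos_def_mat n B \<longrightarrow>
               loewner_le n (mat_fun g (geometric_mean A B)) (mat_fun g (\<sigma> A B))"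
    obtain t where t: "0 < t" "sqrt t \<noteq> f t" using prec by (rule prec_op_neq)
    have pre: "preceq_op sqrt f" using prec by (simp add: prec_op_def)
    then have f: "f \<in> F_op" by (simp add: preceq_op_def)
    have "sqrt t \<le> f t" using pre t(1) by (rule preceq_op_le)
    with t have c: "1 < f t / sqrt t" by simp
    show "operator_monotone g"
    proof (rule operator_monotoneI_local[OF c])
      fix n z z' and C D :: "complex mat" assume C: "C \<in> carrier_mat n n" "D \<in> carrier_mat n n" "D * C = 1\<^sub>m n"
        and z: "\<And>i. i < n \<Longrightarrow> 0 < z i \<and> z i \<le> z' i \<and> z' i \<le> f t / sqrt t * z i"
      have "1 \<le> z' i / z i \<and> z' i / z i \<le> f t / sqrt t" if "i < n" for i
        using z[OF that] by (simp add: pos_divide_le_eq)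
      then show "loewner_le n (mat_fun g (cdiag n C z)) (mat_fun g (cdiag n C z'))"
        using attained[OF f t(1) C, of z z'] z H by metis
    qed
  next
    assume prec: "prec_op f sqrt" and H: "\<forall>n A B. pos_def_mat n A \<and> pos_def_mat n B \<longrightarrow>
               loewner_le n (mat_fun g (\<sigma> A B)) (mat_fun g (geometric_mean A B))"
    obtain t where t: "0 < t" "f t \<noteq> sqrt t" using prec by (rule prec_op_neq)
    have pre: "preceq_op f sqrt" using prec by (simp add: prec_op_def)
    then have f: "f \<in> F_op" by (simp add: preceq_op_def)
    have ft: "0 < f t" using f t by (auto simp: F_op_def)
    have "f t \<le> sqrt t" using pre t(1) by (rule preceq_op_le)
    \<comment> \<open>Now \<open>f t / sqrt t\<close> is below 1, so its reciprocal is the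
      admissible step factor.\<close>
    with t ft have c: "1 < sqrt t / f t" by simp
    show "operator_monotone g"
    proof (rule operator_monotoneI_local[OF c])
      fix n z z' and C D :: "complex mat" assume C: "C \<in> carrier_mat n n" "D \<in> carrier_mat n n" "D * C = 1\<^sub>m n"
        and z: "\<And>i. i < n \<Longrightarrow> 0 < z i \<and> z i \<le> z' i \<and> z' i \<le> sqrt t / f t * z i"
      \<comment> \<open>The roles are exchanged: the larger diagonal \<open>z'\<close> comes from
        the geometric mean and the smaller \<open>z\<close> from \<open>\<sigma>\<close>, so the
        ratio to be attained is \<open>z i / z' i\<close>.\<close>
      have "f t / sqrt t \<le> z i / z' i \<and> z i / z' i \<le> 1" and "0 < z' i" if "i < n" for i
      proof -
        show "0 < z' i" using z[OF that] by simp
        then show "f t / sqrt t \<le> z i / z' i \<and> z i / z' i \<le> 1"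
          using z[OF that] t ft by (simp add: field_simps)
      qed
      then show "loewner_le n (mat_fun g (cdiag n C z)) (mat_fun g (cdiag n C z'))"
        using attained[OF f t(1) C, of z' z] H by metis
    qed
  qed
qed

end
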